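(* Let $N\ge1$. The set $\mathcal{S}_\omega\subset\mathbb{R}^N$ of stable frequencies of the Kuramoto model is convex.
   Context: For $\theta\in\mathbb{T}^N=(\mathbb{R}/2\pi\mathbb{Z})^N$ define $f:\mathbb{T}^N\to\mathbb{R}^N$ by $f_i(\theta)=\sum_{j=1}^N\sin(\theta_j-\theta_i)$, and define $\kappa_i(\theta)=\sum_{j=1}^N\cos(\theta_j-\theta_i)$. Let $\mathcal{S}_\theta$ be the set of $\theta\in\mathbb{T}^N$ for which $\kappa_i(\theta)\ge0$ for all $i$ and $\tau(\theta)=\sum_{i=1}^N\kappa_i(\theta)^{-1}\le 2$ (where $1/0=+\infty$, so in fact all $\kappa_i>0$). Let $\mathcal{S}_\omega=f(\mathcal{S}_\theta)$ be its image. *)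

theory Defs
  imports "HOL-Analysis.Analysis"
begin

definition angle_rel :: "real \<Rightarrow> real \<Rightarrow> bool" where
  "angle_rel x y \<longleftrightarrow> (\<exists>k::int. x - y = 2 * pi * of_int k)"

lemma equivp_angle_rel: "equivp angle_rel"
proof (rule equivpI)
  show "reflp angle_rel"
    by (rule reflpI) (simp add: angle_rel_def)
  show "symp angle_rel"
  proof (rule sympI)
    fix x y assume "angle_rel x y"
    then obtain k :: int where "x - y = 2 * pi * of_int k"
      unfolding angle_rel_def by blast
    then have "y - x = 2 * pi * of_int (- k)" by simp
    then show "angle_rel y x" unfolding angle_rel_def by blast
  qed
  show "transp angle_rel"
  proof (rule transpI)
    fix x y z assume "angle_rel x y" "angle_rel y z"
    then obtain k l :: int where "x - y = 2 * pi * of_int k" "y - z = 2 * pi * of_int l"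
      unfolding angle_rel_def by blast
    then have "x - z = 2 * pi * of_int (k + l)" by (simp add: algebra_simps)
    then show "angle_rel x z" unfolding angle_rel_def by blast
  qed
qed

text \<open>The circle \<open>\<real>/2\<pi>\<int>\<close>; the torus \<open>\<T>\<^sup>N\<close> is then \<open>angle ^ 'n\<close> with \<open>N = CARD('n) \<ge> 1\<close>.\<close>

quotient_type angle = real / angle_rel
  by (rule equivp_angle_rel)

instantiation angle :: minus
begin

lift_definition minus_angle :: "angle \<Rightarrow> angle \<Rightarrow> angle" is "(-)"
proof -
  fix a b c d :: real
  assume "angle_rel a b" "angle_rel c d"
  then obtain k l :: int where "a - b = 2 * pi * of_int k" "c - d = 2 * pi * of_int l"
    unfolding angle_rel_def by blast
  then have "(a - c) - (b - d) = 2 * pi * of_int (k - l)" by (simp add: algebra_simps)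
  then show "angle_rel (a - c) (b - d)" unfolding angle_rel_def by blast
qed

instance ..

end

lift_definition sin_angle :: "angle \<Rightarrow> real" is sin
  by (metis angle_rel_def sin_cos_eq_iff add_diff_cancel_left' diff_add_cancel add.commute)

lift_definition cos_angle :: "angle \<Rightarrow> real" is cos
  by (metis angle_rel_def sin_cos_eq_iff add_diff_cancel_left' diff_add_cancel add.commute)

definition kuramoto_f :: "angle ^ 'n::finite \<Rightarrow> real ^ 'n" where
  "kuramoto_f \<theta> = (\<chi> i. \<Sum>j\<in>UNIV. sin_angle (\<theta> $ j - \<theta> $ i))"

definition kappa :: "angle ^ 'n::finite \<Rightarrow> 'n \<Rightarrow> real" where
  "kappa \<theta> i = (\<Sum>j\<in>UNIV. cos_angle (\<theta> $ j - \<theta> $ i))"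

text \<open>The sum is taken in \<^typ>\<open>ereal\<close>, where \<open>inverse 0 = \<infinity>\<close> (in \<^typ>\<open>real\<close> it would be \<open>0\<close>).\<close>

definition tau :: "angle ^ 'n::finite \<Rightarrow> ereal" where
  "tau \<theta> = (\<Sum>i\<in>UNIV. inverse (ereal (kappa \<theta> i)))"

definition S_theta :: "(angle ^ 'n::finite) set" where
  "S_theta = {\<theta>. (\<forall>i. kappa \<theta> i \<ge> 0) \<and> tau \<theta> \<le> 2}"

definition S_omega :: "(real ^ 'n::finite) set" where
  "S_omega = kuramoto_f ` S_theta"

end

theory Submission imports Defs begin

text \<open>
  Put \<open>C = \<Sum>\<^sub>j cos \<theta>\<^sub>j\<close>, \<open>S = \<Sum>\<^sub>j sin \<theta>\<^sub>j\<close> and \<open>R = C\<^sup>2 + S\<^sup>2\<close>. Then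
  \<open>f\<^sub>i\<^sup>2 + \<kappa>\<^sub>i\<^sup>2 = R\<close>, \<open>\<Sum>\<^sub>i f\<^sub>i = 0\<close> and \<open>\<Sum>\<^sub>i \<kappa>\<^sub>i = R\<close>, so that \<open>R\<close> is a zero of
  \<open>F R \<omega> = (\<Sum>\<^sub>i sqrt (R - \<omega>\<^sub>i\<^sup>2)) - R\<close> at \<open>\<omega> = f \<theta>\<close>. As \<open>\<partial>F/\<partial>R = \<tau>/2 - 1\<close>, the condition
  \<open>\<tau> \<le> 2\<close> holds automatically at the largest zero, which exists as soon as \<open>F R \<omega> \<ge> 0\<close> for
  some admissible \<open>R\<close>. Hence, within the hyperplane \<open>\<Sum>\<^sub>i \<omega>\<^sub>i = 0\<close>, the stable frequencies are
  the projection of \<open>{(R, \<omega>). F R \<omega> \<ge> 0}\<close>, which is convex because \<open>F\<close> is jointly concave.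
\<close>

lemma sin_angle_diff:
  "sin_angle (a - b) = sin_angle a * cos_angle b - cos_angle a * sin_angle b"
  by transfer (rule sin_diff)

lemma cos_angle_diff:
  "cos_angle (a - b) = cos_angle a * cos_angle b + sin_angle a * sin_angle b"
  by transfer (rule cos_diff)

lemma sin_cos_angle_squared_add: "(sin_angle a)\<^sup>2 + (cos_angle a)\<^sup>2 = 1"
  by transfer (rule sin_cos_squared_add)

lemma kuramoto_f_nth:
  "kuramoto_f \<theta> $ i =
    (\<Sum>j\<in>UNIV. sin_angle (\<theta> $ j)) * cos_angle (\<theta> $ i)
    - (\<Sum>j\<in>UNIV. cos_angle (\<theta> $ j)) * sin_angle (\<theta> $ i)"
  by (simp add: kuramoto_f_def sin_angle_diff sum_subtractf sum_distrib_right)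

lemma kappa_eq:
  "kappa \<theta> i =
    (\<Sum>j\<in>UNIV. cos_angle (\<theta> $ j)) * cos_angle (\<theta> $ i)
    + (\<Sum>j\<in>UNIV. sin_angle (\<theta> $ j)) * sin_angle (\<theta> $ i)"
  by (simp add: kappa_def cos_angle_diff sum.distrib sum_distrib_right)

text \<open>This is |Z|^2 for Z = sum_j exp(i \<theta>_j), that is, N^2 times the square of the
  usual Kuramoto order parameter.\<close>

definition order_param_sq :: "angle ^ 'n::finite \<Rightarrow> real" where
  "order_param_sq \<theta> = (\<Sum>j\<in>UNIV. cos_angle (\<theta> $ j))\<^sup>2 + (\<Sum>j\<in>UNIV. sin_angle (\<theta> $ j))\<^sup>2"

lemma sum_kuramoto_f: "(\<Sum>i\<in>UNIV. kuramoto_f \<theta> $ i) = 0"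
  by (simp add: kuramoto_f_nth sum_subtractf flip: sum_distrib_left)

lemma sum_kappa: "(\<Sum>i\<in>UNIV. kappa \<theta> i) = order_param_sq \<theta>"
  by (simp add: kappa_eq order_param_sq_def sum.distrib power2_eq_square flip: sum_distrib_left)

text \<open>In complex form kappa_i + i f_i = exp(-i \<theta>_i) Z, whose modulus |Z| is the same
  for every index.\<close>

lemma kappa_sq_add_kuramoto_f_sq: "(kappa \<theta> i)\<^sup>2 + (kuramoto_f \<theta> $ i)\<^sup>2 = order_param_sq \<theta>"
proof -
  have "(C * c + S * s)\<^sup>2 + (S * c - C * s)\<^sup>2 = (C\<^sup>2 + S\<^sup>2) * (s\<^sup>2 + c\<^sup>2)" for C S c s :: real
    by algebra
  then show ?thesis
    by (simp add: kappa_eq kuramoto_f_nth order_param_sq_def sin_cos_angle_squared_add)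
qed

lemma tau_eq:
  assumes "\<And>i. kappa \<theta> i > 0"
  shows "tau \<theta> = ereal (\<Sum>i\<in>UNIV. inverse (kappa \<theta> i))"
proof -
  have "inverse (ereal (kappa \<theta> i)) = ereal (inverse (kappa \<theta> i))" for i
    using assms[of i] by simp
  then show ?thesis by (simp add: tau_def)
qed

lemma ex_largest_zero:
  fixes \<omega> :: "real ^ 'n::finite"
  assumes le: "\<And>i. (\<omega> $ i)\<^sup>2 \<le> R0" and F: "R0 \<le> (\<Sum>i\<in>UNIV. sqrt (R0 - (\<omega> $ i)\<^sup>2))"
  obtains R where "R \<ge> R0" "(\<Sum>i\<in>UNIV. sqrt (R - (\<omega> $ i)\<^sup>2)) = R"
    "\<And>R'. R' > R \<Longrightarrow> (\<Sum>i\<in>UNIV. sqrt (R' - (\<omega> $ i)\<^sup>2)) < R'"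
proof -
  define F where "F R = (\<Sum>i\<in>UNIV. sqrt (R - (\<omega> $ i)\<^sup>2)) - R" for R
  define A where "A = {R. R0 \<le> R \<and> 0 \<le> F R}"
  have cont: "continuous_on UNIV F" unfolding F_def by (intro continuous_intros)
  have "closed A"
    unfolding A_def by (intro closed_Collect_conj closed_Collect_le continuous_intros cont)
  have "R0 \<ge> 0" using le by (meson order_trans zero_le_power2)
  \<comment> \<open>Each root is at most sqrt R, so \<open>F R\<close> >= 0 forces R <= N sqrt
    R.\<close>
  have bdd: "R \<le> (real CARD('n))\<^sup>2" if "R \<in> A" for R
  proof (cases "R = 0")
    case False
    with that \<open>R0 \<ge> 0\<close> have "R > 0" by (auto simp: A_def)
    have "(\<Sum>i\<in>UNIV. sqrt (R - (\<omega> $ i)\<^sup>2)) \<le> (\<Sum>i\<in>(UNIV::'n set). sqrt R)"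
      by (intro sum_mono) simp
    with that have "sqrt R * sqrt R \<le> real CARD('n) * sqrt R"
      using \<open>R > 0\<close> by (simp add: A_def F_def)
    then have "sqrt R \<le> real CARD('n)"
      using \<open>R > 0\<close> by (elim mult_right_le_imp_le) simp
    then show ?thesis by (rule sqrt_le_D)
  qed simp
  have "R0 \<in> A" using F by (simp add: A_def F_def)
  have "bdd_above A" using bdd by (rule bdd_aboveI)
  define R where "R = Sup A"
  have "R \<in> A"
    unfolding R_def using \<open>R0 \<in> A\<close> \<open>bdd_above A\<close> \<open>closed A\<close>
    by (intro closed_contains_Sup) auto
  have neg: "F R' < 0" if "R' > R" for R'
  proof (rule ccontr)
    assume "\<not> F R' < 0"
    with that \<open>R \<in> A\<close> have "R' \<in> A" by (simp add: A_def)
    then have "R' \<le> R" unfolding R_def using \<open>bdd_above A\<close> by (rule cSup_upper)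
    with that show False by simp
  qed
  \<comment> \<open>\<open>F\<close> is negative to the right of the supremum, so continuity from
    the right gives \<open>F R\<close> <= 0 there.\<close>
  have "(F \<longlongrightarrow> F R) (at_right R)"
    using cont by (auto simp: continuous_on_def intro: tendsto_within_subset)
  moreover have "eventually (\<lambda>x. F x \<le> 0) (at_right R)"
    using neg by (auto simp: eventually_at_filter less_imp_le)
  ultimately have "F R \<le> 0"
    by (rule tendsto_upperbound) simp
  with \<open>R \<in> A\<close> have "F R = 0" "R \<ge> R0" by (auto simp: A_def)
  then show ?thesis using neg that[of R] by (simp add: F_def)
qed

text \<open>Turns maximality of the zero R into stability. With k_i = sqrt (R - \<omega>_i^2),
  \<open>incr\<close> says that \<open>F\<close> is negative at R + h; dividing by h and letting h
  tend to 0 from the right gives the sum of the 1/(2 k_i) at most 1.\<close>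

lemma sum_inverse_le_2_of_sqrt_increments:
  fixes k :: "'n::finite \<Rightarrow> real"
  assumes nonneg: "\<And>i. k i \<ge> 0"
    and incr: "\<And>h. h > 0 \<Longrightarrow> (\<Sum>i\<in>UNIV. sqrt ((k i)\<^sup>2 + h) - k i) < h"
  shows "\<And>i. k i > 0" and "(\<Sum>i\<in>UNIV. inverse (k i)) \<le> 2"
proof -
  show pos: "k i > 0" for i
  proof (rule ccontr)
    assume "\<not> k i > 0"
    then have "k i = 0" using nonneg[of i] by simp
    \<comment> \<open>At h = 1 a vanishing k_i alone contributes 1, and the other increments are
      nonnegative.\<close>
    have "sqrt ((k i)\<^sup>2 + 1) - k i \<le> (\<Sum>i\<in>UNIV. sqrt ((k i)\<^sup>2 + 1) - k i)"
      by (rule member_le_sum) (auto intro: real_le_rsqrt)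
    with incr[of 1] \<open>k i = 0\<close> show False by simp
  qed
  \<comment> \<open>The difference quotient with its numerator rationalised, so that h = 0 may be
    substituted.\<close>
  define G where "G h = (\<Sum>i\<in>UNIV. 1 / (sqrt ((k i)\<^sup>2 + h) + k i))" for h
  have "G h \<le> 1" if "h > 0" for h
  proof -
    have "sqrt ((k i)\<^sup>2 + h) - k i = h * (1 / (sqrt ((k i)\<^sup>2 + h) + k i))" for i
    proof -
      have "sqrt ((k i)\<^sup>2 + h) + k i > 0" using pos[of i] that by (simp add: add_nonneg_pos)
      moreover have "(sqrt ((k i)\<^sup>2 + h) - k i) * (sqrt ((k i)\<^sup>2 + h) + k i) = h"
        using that by (simp add: algebra_simps power2_eq_square[symmetric])
      ultimately show ?thesis by (simp add: field_simps)
    qed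
    then have "h * G h < h" using incr[OF that] by (simp add: G_def sum_distrib_left)
    then show ?thesis using that by simp
  qed
  then have "eventually (\<lambda>h. G h \<le> 1) (at_right 0)"
    by (simp add: eventually_at_filter)
  moreover have "(G \<longlongrightarrow> (\<Sum>i\<in>UNIV. 1 / (sqrt ((k i)\<^sup>2 + 0) + k i))) (at_right 0)"
    unfolding G_def using pos by (intro tendsto_intros) (auto simp: less_imp_neq[symmetric] abs_of_pos)
  ultimately have "(\<Sum>i\<in>UNIV. 1 / (sqrt ((k i)\<^sup>2 + 0) + k i)) \<le> 1"
    by (intro tendsto_upperbound) auto
  moreover have "1 / (sqrt ((k i)\<^sup>2 + 0) + k i) = inverse (k i) / 2" for i
    using pos[of i] by (simp add: field_simps)
  ultimately show "(\<Sum>i\<in>UNIV. inverse (k i)) \<le> 2"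
    by (simp only: flip: sum_divide_distrib)
qed

lemma mem_S_omegaI:
  fixes \<omega> :: "real ^ 'n::finite"
  assumes sum0: "(\<Sum>i\<in>UNIV. \<omega> $ i) = 0"
    and le: "\<And>i. (\<omega> $ i)\<^sup>2 \<le> R0" and F: "R0 \<le> (\<Sum>i\<in>UNIV. sqrt (R0 - (\<omega> $ i)\<^sup>2))"
  shows "\<omega> \<in> S_omega"
proof -
  obtain R where "R \<ge> R0" and zero: "(\<Sum>i\<in>UNIV. sqrt (R - (\<omega> $ i)\<^sup>2)) = R"
    and neg: "\<And>R'. R' > R \<Longrightarrow> (\<Sum>i\<in>UNIV. sqrt (R' - (\<omega> $ i)\<^sup>2)) < R'"
    using ex_largest_zero[OF le F] by blast
  define k where "k i = sqrt (R - (\<omega> $ i)\<^sup>2)" for i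
  have leR: "(\<omega> $ i)\<^sup>2 \<le> R" for i using le[of i] \<open>R \<ge> R0\<close> by simp
  have k_sq: "(k i)\<^sup>2 = R - (\<omega> $ i)\<^sup>2" for i using leR[of i] by (simp add: k_def)
  have k_nonneg: "k i \<ge> 0" for i using leR[of i] by (simp add: k_def)
  have sum_k: "(\<Sum>i\<in>UNIV. k i) = R" using zero by (simp add: k_def)
  have "(\<Sum>i\<in>UNIV. sqrt ((k i)\<^sup>2 + h) - k i) < h" if "h > 0" for h
    using neg[of "R + h"] that by (simp add: sum_subtractf sum_k k_sq algebra_simps)
  note pos = sum_inverse_le_2_of_sqrt_increments[OF k_nonneg this]
  have "R > 0" unfolding sum_k[symmetric] using pos(1) by (intro sum_pos) auto
  define r where "r = sqrt R"
  have "r > 0" and r_sq: "r * r = R" using \<open>R > 0\<close> by (auto simp: r_def)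
  \<comment> \<open>Up to a common rotation Z is the positive real r; then f_i = -r sin \<theta>_i
    and kappa_i = r cos \<theta>_i. Wanting kappa_i >= 0 selects the branch of
    \<open>arcsin\<close>.\<close>
  define \<theta> :: "angle ^ 'n" where "\<theta> = (\<chi> i. abs_angle (- arcsin (\<omega> $ i / r)))"
  have "\<bar>\<omega> $ i / r\<bar> \<le> 1" for i
    using real_sqrt_le_mono[OF leR[of i]] \<open>r > 0\<close> by (simp add: r_def)
  then have bound: "- 1 \<le> \<omega> $ i / r" "\<omega> $ i / r \<le> 1" for i
    unfolding abs_le_iff by (simp_all add: minus_le_iff)
  have sin: "sin_angle (\<theta> $ i) = - \<omega> $ i / r" for i
    by (simp add: \<theta>_def sin_angle.abs_eq sin_arcsin[OF bound])
  have cos: "cos_angle (\<theta> $ i) = k i / r" for i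
  proof -
    have "cos_angle (\<theta> $ i) = sqrt (1 - (\<omega> $ i / r)\<^sup>2)"
      by (simp add: \<theta>_def cos_angle.abs_eq cos_arcsin[OF bound])
    also have "1 - (\<omega> $ i / r)\<^sup>2 = (R - (\<omega> $ i)\<^sup>2) / R"
      using \<open>R > 0\<close> r_sq by (simp add: power_divide power2_eq_square diff_divide_distrib)
    finally show ?thesis by (simp add: real_sqrt_divide k_def r_def)
  qed
  \<comment> \<open>Self-consistency: these angles must reproduce Z = r. The imaginary part vanishes
    by \<open>sum0\<close>; the real part is R / r = r because R is a zero of
    \<open>F\<close>.\<close>
  have sum_sin: "(\<Sum>j\<in>UNIV. sin_angle (\<theta> $ j)) = 0"
    using sum0 by (simp add: sin sum_negf flip: sum_divide_distrib)
  have sum_cos: "(\<Sum>j\<in>UNIV. cos_angle (\<theta> $ j)) = r"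
    using sum_k r_sq \<open>r > 0\<close> by (simp add: cos field_simps flip: sum_divide_distrib)
  have "kuramoto_f \<theta> = \<omega>"
    unfolding vec_eq_iff kuramoto_f_nth sum_sin sum_cos using \<open>r > 0\<close> by (simp add: sin)
  moreover have kappa: "kappa \<theta> i = k i" for i
    unfolding kappa_eq sum_sin sum_cos using \<open>r > 0\<close> by (simp add: cos)
  then have "\<theta> \<in> S_theta"
    using pos k_nonneg by (simp add: S_theta_def tau_eq)
  ultimately show ?thesis unfolding S_omega_def by blast
qed

lemma S_omega_eq:
  "(S_omega :: (real ^ 'n::finite) set) =
    {\<omega>. (\<Sum>i\<in>UNIV. \<omega> $ i) = 0 \<and>
      (\<exists>R. (\<forall>i. (\<omega> $ i)\<^sup>2 \<le> R) \<and> R \<le> (\<Sum>i\<in>UNIV. sqrt (R - (\<omega> $ i)\<^sup>2)))}"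
proof (intro equalityI subsetI)
  fix \<omega> :: "real ^ 'n"
  assume "\<omega> \<in> S_omega"
  then obtain \<theta> where \<omega>: "\<omega> = kuramoto_f \<theta>" and nonneg: "\<And>i. kappa \<theta> i \<ge> 0"
    by (auto simp: S_omega_def S_theta_def)
  have kappa_sq: "order_param_sq \<theta> - (\<omega> $ i)\<^sup>2 = (kappa \<theta> i)\<^sup>2" for i
    using kappa_sq_add_kuramoto_f_sq[of \<theta> i] by (simp add: \<omega>)
  then have "(\<omega> $ i)\<^sup>2 \<le> order_param_sq \<theta>" for i
    by (metis diff_ge_0_iff_ge zero_le_power2)
  moreover have "(\<Sum>i\<in>UNIV. sqrt (order_param_sq \<theta> - (\<omega> $ i)\<^sup>2)) = order_param_sq \<theta>"
    using nonneg by (simp add: kappa_sq sum_kappa)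
  ultimately show "\<omega> \<in> {\<omega>. (\<Sum>i\<in>UNIV. \<omega> $ i) = 0 \<and>
      (\<exists>R. (\<forall>i. (\<omega> $ i)\<^sup>2 \<le> R) \<and> R \<le> (\<Sum>i\<in>UNIV. sqrt (R - (\<omega> $ i)\<^sup>2)))}"
    using sum_kuramoto_f[of \<theta>] unfolding \<omega> by fastforce
qed (auto intro: mem_S_omegaI)

text \<open>For a >= 0, a <= sqrt (R - x^2) means a^2 + x^2 <= R, so concavity of the root is
  convexity of the squared Euclidean norm on the plane.\<close>

lemma sqrt_diff_square_concave:
  fixes x y R T u v :: real
  assumes R: "x\<^sup>2 \<le> R" and T: "y\<^sup>2 \<le> T" and uv: "u \<ge> 0" "v \<ge> 0" "u + v = 1"
  shows "(u * x + v * y)\<^sup>2 \<le> u * R + v * T"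
    and "u * sqrt (R - x\<^sup>2) + v * sqrt (T - y\<^sup>2) \<le> sqrt (u * R + v * T - (u * x + v * y)\<^sup>2)"
proof -
  define a b where "a = sqrt (R - x\<^sup>2)" and "b = sqrt (T - y\<^sup>2)"
  have R_eq: "R = a\<^sup>2 + x\<^sup>2" and T_eq: "T = b\<^sup>2 + y\<^sup>2" using R T by (auto simp: a_def b_def)
  have v: "v = 1 - u" using uv by simp
  \<comment> \<open>The convexity defect of the squared norm between the points (a, x) and (b,
    y).\<close>
  have "u * R + v * T - (u * x + v * y)\<^sup>2 - (u * a + v * b)\<^sup>2
      = u * v * ((a - b)\<^sup>2 + (x - y)\<^sup>2)"
    unfolding R_eq T_eq v by algebra
  then have *: "(u * a + v * b)\<^sup>2 \<le> u * R + v * T - (u * x + v * y)\<^sup>2"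
    using uv by (smt (verit) mult_nonneg_nonneg sum_power2_ge_zero)
  then show "(u * x + v * y)\<^sup>2 \<le> u * R + v * T"
    by (smt (verit) zero_le_power2)
  show "u * sqrt (R - x\<^sup>2) + v * sqrt (T - y\<^sup>2) \<le> sqrt (u * R + v * T - (u * x + v * y)\<^sup>2)"
    using real_le_rsqrt[OF *] by (simp add: a_def b_def)
qed

theorem theorem2p5:
  "convex (S_omega :: (real ^ 'n::finite) set)"
proof (rule convexI)
  fix x y :: "real ^ 'n" and u v :: real
  assume "x \<in> S_omega" "y \<in> S_omega" and uv: "u \<ge> 0" "v \<ge> 0" "u + v = 1"
  then obtain R T where sum0: "(\<Sum>i\<in>UNIV. x $ i) = 0" "(\<Sum>i\<in>UNIV. y $ i) = 0"
    and R: "\<And>i. (x $ i)\<^sup>2 \<le> R" "R \<le> (\<Sum>i\<in>UNIV. sqrt (R - (x $ i)\<^sup>2))"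
    and T: "\<And>i. (y $ i)\<^sup>2 \<le> T" "T \<le> (\<Sum>i\<in>UNIV. sqrt (T - (y $ i)\<^sup>2))"
    by (auto simp: S_omega_eq)
  note concave = sqrt_diff_square_concave[OF R(1) T(1) uv]
  show "u *\<^sub>R x + v *\<^sub>R y \<in> S_omega"
  \<comment> \<open>The witness \<open>R0\<close> is the same convex combination u R + v T of the
    two given values.\<close>
  proof (rule mem_S_omegaI)
    show "(\<Sum>i\<in>UNIV. (u *\<^sub>R x + v *\<^sub>R y) $ i) = 0"
      using sum0 by (simp add: sum.distrib flip: sum_distrib_left)
    show "((u *\<^sub>R x + v *\<^sub>R y) $ i)\<^sup>2 \<le> u * R + v * T" for i
      using concave(1) by simp
    have "u * R + v * T
        \<le> u * (\<Sum>i\<in>UNIV. sqrt (R - (x $ i)\<^sup>2)) + v * (\<Sum>i\<in>UNIV. sqrt (T - (y $ i)\<^sup>2))"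
      using R(2) T(2) uv by (intro add_mono mult_left_mono)
    also have "\<dots> = (\<Sum>i\<in>UNIV. u * sqrt (R - (x $ i)\<^sup>2) + v * sqrt (T - (y $ i)\<^sup>2))"
      by (simp add: sum.distrib sum_distrib_left)
    also have "\<dots> \<le> (\<Sum>i\<in>UNIV. sqrt (u * R + v * T - ((u *\<^sub>R x + v *\<^sub>R y) $ i)\<^sup>2))"
      using concave(2) by (intro sum_mono) simp
    finally show "u * R + v * T
        \<le> (\<Sum>i\<in>UNIV. sqrt (u * R + v * T - ((u *\<^sub>R x + v *\<^sub>R y) $ i)\<^sup>2))" .
  qed
qed

end
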